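(* Let $n\in\mathbb{N}$ and $k\in\{2,\ldots,n\}$. There is a bijection between the set of nonempty faces of $\Pi_{n-1}(k-1)$ and the set of ordered pseudo-partitions $(Z,X_0,\ldots,X_p)$ of $[n]$ satisfying (i) $0\le |Z|\le k-1$ and (ii) $k\le |Z|+|X_0|\le n$, under which a face of dimension $d$ corresponds to an ordered pseudo-partition with (iii) $n-|Z|-p-1=d$.
   Context: $[n]=\{1,\ldots,n\}$. For $F\subseteq[n]$, $\Delta_F=\{\tilde{x}\in\mathbb{R}^n: x_i\ge0,\ \sum_ix_i=1,\ x_i=0\text{ for }i\notin F\}$, and $\Pi_{n-1}(k-1)=\sum_{F\subseteq[n],|F|=k}\Delta_F$ (Minkowski sum). An ordered pseudo-partition of $[n]$ is a tuple $(Z,X_0,\ldots,X_p)$ ($p\ge 0$) of pairwise disjoint subsets with $Z\cup X_0\cup\cdots\cup X_p=[n]$ such that either $(X_0,\ldots,X_p)$ or $(Z,X_0,\ldots,X_p)$ is an ordered partition of $[n]$ into nonempty parts (so $Z$ may be empty, while each $X_i$ is nonempty). *)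

theory Defs
  imports "HOL-Analysis.Analysis"
begin

text \<open>
  The ground set \<open>[n]\<close> is \<open>UNIV :: 'n set\<close> for a finite index type \<open>'n\<close>, with \<open>n = CARD('n)\<close>,
  and \<open>real ^ 'n\<close> is the ambient space.
\<close>

definition coord_simplex :: "'n::finite set \<Rightarrow> (real ^ 'n) set" where
  "coord_simplex F =
     {x. (\<forall>i. 0 \<le> x $ i) \<and> (\<Sum>i\<in>UNIV. x $ i) = 1 \<and> (\<forall>i. i \<notin> F \<longrightarrow> x $ i = 0)}"

text \<open>
  The polytope \<open>\<Pi>\<^bsub>n-1\<^esub>(k-1)\<close> is \<open>simplex_sum k\<close>: the argument is the size \<open>k\<close> of the sets \<open>F\<close>.
  The sum is the Minkowski sum of sets from \<^theory>\<open>HOL-Library.Set_Algebras\<close>.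
\<close>

definition simplex_sum :: "nat \<Rightarrow> (real ^ 'n::finite) set" where
  "simplex_sum k = (\<Sum>F\<in>{F :: 'n set. F \<subseteq> UNIV \<and> card F = k}. coord_simplex F)"

definition ordered_partition :: "'a set \<Rightarrow> 'a set list \<Rightarrow> bool" where
  "ordered_partition A Xs \<longleftrightarrow>
     (\<forall>X\<in>set Xs. X \<noteq> {}) \<and>
     disjoint_family_on (\<lambda>i. Xs ! i) {..<length Xs} \<and>
     \<Union>(set Xs) = A"

text \<open>
  The tuple \<open>(Z, X\<^sub>0, \<dots>, X\<^sub>p)\<close> is represented by \<open>Z\<close> and the nonempty list \<open>Xs = [X\<^sub>0, \<dots>, X\<^sub>p]\<close>,
  so \<open>p = length Xs - 1\<close> and \<open>X\<^sub>0 = hd Xs\<close>.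
\<close>

definition ordered_pseudo_partition :: "'a set \<Rightarrow> 'a set \<Rightarrow> 'a set list \<Rightarrow> bool" where
  "ordered_pseudo_partition A Z Xs \<longleftrightarrow>
     Xs \<noteq> [] \<and>
     disjoint_family_on (\<lambda>i. (Z # Xs) ! i) {..<length (Z # Xs)} \<and>
     \<Union>(set (Z # Xs)) = A \<and>
     (ordered_partition A Xs \<or> ordered_partition A (Z # Xs))"

end

theory Submission
  imports Defs
begin

text \<open>
  The face of a Minkowski sum on which a linear functional \<open>c\<close> is maximal is the sum of the
  corresponding faces of the summands. The summand \<open>\<Delta>\<^sub>F\<close> contributes \<open>\<Delta>\<^sub>G\<close>, where \<open>G\<close> is the set
  of maximizers of \<open>c\<close> on \<open>F\<close>, so the face is determined by the maximizers of \<open>c\<close> on all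
  \<open>k\<close>-sets, and it determines them. These maximizers see the order of the values of \<open>c\<close>, except
  that they cannot distinguish the elements \<open>i\<close> with fewer than \<open>k\<close> values at most \<open>c i\<close>, which
  are never maximizers. Those elements form \<open>Z\<close>, and \<open>X\<^sub>0, X\<^sub>1, \<dots>\<close> are the remaining level sets in
  increasing order. The directions of the face are spanned by the differences \<open>e\<^sub>i - e\<^sub>j\<close> with \<open>i\<close>
  and \<open>j\<close> in the same \<open>X\<^sub>m\<close>, which gives the dimension \<open>\<Sum>\<^sub>m (|X\<^sub>m| - 1)\<close>.
\<close>

section \<open>Faces as sums of simplices on maximizers\<close>

text \<open>The codomain is polymorphic because the notion is applied both to the real coordinates
  of a functional and to natural-number levels.\<close>

definition maximizers :: "('a \<Rightarrow> 'b::linorder) \<Rightarrow> 'a set \<Rightarrow> 'a set" where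
  "maximizers c F = {i \<in> F. \<forall>j\<in>F. c j \<le> c i}"

text \<open>Built from maximizers alone, so functions with the same maximizers on all
  \<open>k\<close>-sets visibly give the same set. For a real vector,
  \<open>max_face_eq_supporting\<close> identifies it with the supported face.\<close>

definition max_face :: "nat \<Rightarrow> ('n::finite \<Rightarrow> 'b::linorder) \<Rightarrow> (real ^ 'n) set" where
  "max_face k c = (\<Sum>F\<in>{F. card F = k}. coord_simplex (maximizers c F))"

lemma maximizers_nonempty:
  assumes "finite F" "F \<noteq> {}"
  shows "maximizers c F \<noteq> {}"
proof -
  have "Max (c ` F) \<in> c ` F"
    using assms by (intro Max_in) auto
  then obtain i where "i \<in> F" "c i = Max (c ` F)"
    by auto
  with assms have "i \<in> maximizers c F"
    by (simp add: maximizers_def)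
  then show ?thesis
    by blast
qed

lemma mem_simplex_sum_iff:
  "x \<in> simplex_sum k \<longleftrightarrow>
     (\<exists>y. (\<forall>F. card F = k \<longrightarrow> y F \<in> coord_simplex F) \<and> x = (\<Sum>F | card F = k. y F))"
  unfolding simplex_sum_def by (auto simp: set_sum_alt)

lemma mem_max_face_iff:
  "x \<in> max_face k c \<longleftrightarrow>
     (\<exists>y. (\<forall>F. card F = k \<longrightarrow> y F \<in> coord_simplex (maximizers c F)) \<and>
          x = (\<Sum>F | card F = k. y F))"
  unfolding max_face_def by (auto simp: set_sum_alt)

lemma max_face_cong:
  assumes "\<And>F. card F = k \<Longrightarrow> maximizers c F = maximizers d F"
  shows "max_face k c = max_face k d"
  unfolding max_face_def using assms by (intro sum.cong) auto

lemma axis_mem_coord_simplex: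
  "i \<in> F \<Longrightarrow> axis i 1 \<in> coord_simplex F"
  by (auto simp: coord_simplex_def axis_def)

lemma max_face_nonempty:
  fixes c :: "'n::finite \<Rightarrow> 'b::linorder"
  assumes "1 \<le> k"
  shows "max_face k c \<noteq> {}"
proof -
  have "\<exists>y. y \<in> coord_simplex (maximizers c F)" if "card F = k" for F
  proof -
    from that assms have "F \<noteq> {}"
      by auto
    then obtain i where "i \<in> maximizers c F"
      using maximizers_nonempty[of F c] by auto
    then show ?thesis
      using axis_mem_coord_simplex by blast
  qed
  then have "\<exists>y. \<forall>F. card F = k \<longrightarrow> y F \<in> coord_simplex (maximizers c F)"
    by metis
  then show ?thesis
    using mem_max_face_iff by blast
qed

section \<open>The simplex sum as a polytope\<close>

lemma coord_simplex_eq_hull: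
  "coord_simplex F = convex hull ((\<lambda>i. axis i 1) ` F)"
proof
  show "coord_simplex F \<subseteq> convex hull ((\<lambda>i. axis i 1) ` F)"
  proof
    fix x assume x: "x \<in> coord_simplex F"
    have "x = (\<Sum>i\<in>UNIV. x $ i *\<^sub>R axis i 1)"
      using basis_expansion[of x] by (simp add: scalar_mult_eq_scaleR)
    also have "\<dots> = (\<Sum>i\<in>F. x $ i *\<^sub>R axis i 1)"
      using x by (intro sum.mono_neutral_right) (auto simp: coord_simplex_def)
    finally have eq: "x = (\<Sum>i\<in>F. x $ i *\<^sub>R axis i 1)" .
    have "(\<Sum>i\<in>F. x $ i) = (\<Sum>i\<in>UNIV. x $ i)"
      using x by (intro sum.mono_neutral_left) (auto simp: coord_simplex_def)
    with x have "(\<Sum>i\<in>F. x $ i *\<^sub>R axis i 1) \<in> convex hull ((\<lambda>i. axis i 1) ` F)"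
      by (intro convex_sum) (auto simp: coord_simplex_def intro: hull_inc)
    then show "x \<in> convex hull ((\<lambda>i. axis i 1) ` F)"
      by (subst eq)
  qed
  show "convex hull ((\<lambda>i. axis i 1) ` F) \<subseteq> coord_simplex F"
  proof (rule hull_minimal)
    show "(\<lambda>i. axis i 1) ` F \<subseteq> coord_simplex F"
      using axis_mem_coord_simplex by blast
    show "convex (coord_simplex F)"
      unfolding coord_simplex_def convex_def
      by (auto simp: sum.distrib sum_distrib_left[symmetric])
  qed
qed

lemma finite_set_sum:
  assumes "\<And>i. i \<in> A \<Longrightarrow> finite (B i)"
  shows "finite (\<Sum>i\<in>A. B i)"
  using assms by (induction A rule: infinite_finite_induct) (auto intro: finite_set_plus)

text \<open>Convex hulls commute with Minkowski sums, so the whole sum is the hull of the finite sum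
  of the vertex sets.\<close>

lemma polytope_simplex_sum: "polytope (simplex_sum k)"
  unfolding polytope_def simplex_sum_def coord_simplex_eq_hull convex_hull_set_sum[symmetric]
  by (rule exI, rule conjI[OF finite_set_sum refl]) simp

section \<open>Linear functionals on the simplex sum\<close>

lemma inner_coord_simplex:
  fixes a x :: "real ^ 'n::finite"
  assumes x: "x \<in> coord_simplex F" and "F \<noteq> {}"
  shows inner_coord_simplex_le: "a \<bullet> x \<le> Max (($) a ` F)"
    and inner_coord_simplex_eq_iff:
      "a \<bullet> x = Max (($) a ` F) \<longleftrightarrow> x \<in> coord_simplex (maximizers (($) a) F)"
proof -
  let ?M = "Max (($) a ` F)"
  have out: "x $ i = 0" if "i \<notin> F" for i
    using x that by (simp add: coord_simplex_def)
  have pos: "0 \<le> x $ i" for i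
    using x by (simp add: coord_simplex_def)
  have max: "i \<in> F \<Longrightarrow> a $ i \<le> ?M" for i
    by simp
  \<comment> \<open>The inner product averages the coordinates of \<open>a\<close> with weights
    \<open>x $ i\<close>. Its gap to the maximum is a sum of nonnegative terms, which vanishes only
    if all weight sits on maximizers.\<close>
  have "?M - a \<bullet> x = (\<Sum>i\<in>UNIV. ?M * x $ i) - (\<Sum>i\<in>UNIV. a $ i * x $ i)"
    using x by (simp add: inner_vec_def sum_distrib_left[symmetric] coord_simplex_def)
  also have "\<dots> = (\<Sum>i\<in>UNIV. (?M - a $ i) * x $ i)"
    by (simp add: sum_subtractf left_diff_distrib)
  finally have eq: "?M - a \<bullet> x = (\<Sum>i\<in>UNIV. (?M - a $ i) * x $ i)" .
  have nonneg: "0 \<le> (?M - a $ i) * x $ i" for i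
    using out pos max by (cases "i \<in> F") auto
  then have "0 \<le> (\<Sum>i\<in>UNIV. (?M - a $ i) * x $ i)"
    by (simp add: sum_nonneg)
  with eq show "a \<bullet> x \<le> ?M"
    by simp
  have M: "i \<in> maximizers (($) a) F \<longleftrightarrow> i \<in> F \<and> a $ i = ?M" for i
    using assms(2) by (auto simp: maximizers_def eq_Max_iff intro!: Max_eqI)
  have "a \<bullet> x = ?M \<longleftrightarrow> (\<Sum>i\<in>UNIV. (?M - a $ i) * x $ i) = 0"
    using eq by auto
  also have "\<dots> \<longleftrightarrow> (\<forall>i. (?M - a $ i) * x $ i = 0)"
    using nonneg by (subst sum_nonneg_eq_0_iff) auto
  also have "\<dots> \<longleftrightarrow> (\<forall>i. i \<notin> maximizers (($) a) F \<longrightarrow> x $ i = 0)"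
    by (metis M mult_eq_0_iff out right_minus_eq)
  also have "\<dots> \<longleftrightarrow> x \<in> coord_simplex (maximizers (($) a) F)"
    using x by (auto simp: coord_simplex_def)
  finally show "a \<bullet> x = ?M \<longleftrightarrow> x \<in> coord_simplex (maximizers (($) a) F)" .
qed

text \<open>The support function of the Minkowski sum, which is additive over the summands.\<close>

definition support_value :: "nat \<Rightarrow> real ^ 'n::finite \<Rightarrow> real" where
  "support_value k a = (\<Sum>F | card F = k. Max (($) a ` F))"

text \<open>Each summand is bounded by its own maximum, so the total reaches the bound exactly when
  every summand does.\<close>

lemma sum_coord_simplex_support:
  fixes a :: "real ^ 'n::finite"
  assumes "1 \<le> k" and y: "\<And>F. card F = k \<Longrightarrow> y F \<in> coord_simplex F"
  shows sum_coord_simplex_le: "a \<bullet> (\<Sum>F | card F = k. y F) \<le> support_value k a"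
    and sum_coord_simplex_eq_iff: "a \<bullet> (\<Sum>F | card F = k. y F) = support_value k a \<longleftrightarrow>
      (\<forall>F. card F = k \<longrightarrow> y F \<in> coord_simplex (maximizers (($) a) F))"
proof -
  have ne: "F \<noteq> {}" if "card F = k" for F :: "'n set"
    using that assms(1) by auto
  have le: "a \<bullet> y F \<le> Max (($) a ` F)" if "card F = k" for F
    using inner_coord_simplex_le[OF y ne] that by blast
  then show "a \<bullet> (\<Sum>F | card F = k. y F) \<le> support_value k a"
    unfolding support_value_def inner_sum_right by (intro sum_mono) auto
  have "a \<bullet> (\<Sum>F | card F = k. y F) = support_value k a \<longleftrightarrow>
      (\<forall>F. card F = k \<longrightarrow> a \<bullet> y F = Max (($) a ` F))"
  proof
    assume "a \<bullet> (\<Sum>F | card F = k. y F) = support_value k a"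
    then have "(\<Sum>F | card F = k. Max (($) a ` F) - a \<bullet> y F) = 0"
      by (simp add: support_value_def inner_sum_right sum_subtractf)
    then show "\<forall>F. card F = k \<longrightarrow> a \<bullet> y F = Max (($) a ` F)"
      using le by (subst (asm) sum_nonneg_eq_0_iff) auto
  qed (auto simp: support_value_def inner_sum_right)
  then show "a \<bullet> (\<Sum>F | card F = k. y F) = support_value k a \<longleftrightarrow>
      (\<forall>F. card F = k \<longrightarrow> y F \<in> coord_simplex (maximizers (($) a) F))"
    using inner_coord_simplex_eq_iff[OF y ne, of _ a] by auto
qed

lemma coord_simplex_mono: "F \<subseteq> G \<Longrightarrow> coord_simplex F \<subseteq> coord_simplex G"
  by (auto simp: coord_simplex_def)

lemma max_face_eq_supporting:
  assumes "1 \<le> k"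
  shows "max_face k (($) a) = simplex_sum k \<inter> {x. a \<bullet> x = support_value k a}"
proof -
  have sub: "coord_simplex (maximizers (($) a) F) \<subseteq> coord_simplex F" for F
    by (rule coord_simplex_mono) (auto simp: maximizers_def)
  show ?thesis
  proof (intro equalityI subsetI)
    fix x assume "x \<in> max_face k (($) a)"
    then obtain y where y: "\<And>F. card F = k \<Longrightarrow> y F \<in> coord_simplex (maximizers (($) a) F)"
      and x: "x = (\<Sum>F | card F = k. y F)"
      by (auto simp: mem_max_face_iff)
    from y sub have y': "\<And>F. card F = k \<Longrightarrow> y F \<in> coord_simplex F"
      by blast
    then show "x \<in> simplex_sum k \<inter> {x. a \<bullet> x = support_value k a}"
      using sum_coord_simplex_eq_iff[OF assms y', of a] y x by (auto simp: mem_simplex_sum_iff)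
  next
    fix x assume "x \<in> simplex_sum k \<inter> {x. a \<bullet> x = support_value k a}"
    then obtain y where y: "\<And>F. card F = k \<Longrightarrow> y F \<in> coord_simplex F"
      and x: "x = (\<Sum>F | card F = k. y F)" and "a \<bullet> x = support_value k a"
      by (auto simp: mem_simplex_sum_iff)
    then show "x \<in> max_face k (($) a)"
      using sum_coord_simplex_eq_iff[OF assms y, of a] by (auto simp: mem_max_face_iff)
  qed
qed

text \<open>Every face of a polytope is exposed, hence cut out by a functional; the polytope itself
  comes from \<open>a = 0\<close>.\<close>

lemma face_of_simplex_sum_iff:
  fixes T :: "(real ^ 'n::finite) set"
  assumes "1 \<le> k"
  shows "T face_of simplex_sum k \<and> T \<noteq> {} \<longleftrightarrow> (\<exists>a :: real ^ 'n. T = max_face k (($) a))"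
proof
  assume T: "T face_of simplex_sum k \<and> T \<noteq> {}"
  then have "T exposed_face_of simplex_sum k"
    using polytope_simplex_sum[of k] polytope_eq_bounded_polyhedron exposed_face_of_polyhedron
    by blast
  then obtain a b where ab: "simplex_sum k \<subseteq> {x. a \<bullet> x \<le> b}"
    "T = simplex_sum k \<inter> {x. a \<bullet> x = b}"
    unfolding exposed_face_of_def by blast
  \<comment> \<open>\<open>b\<close> must equal the maximum of \<open>a\<close>: the polytope
    contains a maximizer, and the nonempty \<open>T\<close> contains a point of height
    \<open>b\<close>.\<close>
  obtain x where "x \<in> max_face k (($) a)"
    using max_face_nonempty[OF assms] by blast
  then have "support_value k a \<le> b"
    using ab(1) by (auto simp: max_face_eq_supporting[OF assms])
  moreover obtain x where "x \<in> simplex_sum k" "a \<bullet> x = b"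
    using T ab(2) by auto
  then have "b \<le> support_value k a"
    using sum_coord_simplex_le[OF assms, of _ a] by (auto simp: mem_simplex_sum_iff)
  ultimately have "T = max_face k (($) a)"
    using ab(2) by (simp add: max_face_eq_supporting[OF assms])
  then show "\<exists>a :: real ^ 'n. T = max_face k (($) a)"
    by blast
next
  assume "\<exists>a :: real ^ 'n. T = max_face k (($) a)"
  then obtain a :: "real ^ 'n" where T: "T = max_face k (($) a)"
    by blast
  have "T face_of simplex_sum k"
    unfolding T max_face_eq_supporting[OF assms]
  proof (rule face_of_Int_supporting_hyperplane_le)
    show "convex (simplex_sum k :: (real ^ 'n) set)"
      using polytope_simplex_sum polytope_imp_convex by blast
    show "a \<bullet> x \<le> support_value k a" if "x \<in> simplex_sum k" for x
      using that sum_coord_simplex_le[OF assms, of _ a] by (auto simp: mem_simplex_sum_iff)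
  qed
  with T max_face_nonempty[OF assms] show "T face_of simplex_sum k \<and> T \<noteq> {}"
    by auto
qed

text \<open>
  The sum of the barycentres of the summands of one face lies in the other face only if every
  barycentre lies in the corresponding summand of the other face.
\<close>

lemma max_face_subset_imp_maximizers_subset:
  fixes c :: "'n::finite \<Rightarrow> 'b::linorder" and a :: "real ^ 'n"
  assumes "1 \<le> k" and sub: "max_face k c \<subseteq> max_face k (($) a)" and F: "card F = k"
  shows "maximizers c F \<subseteq> maximizers (($) a) F"
proof -
  define y :: "'n set \<Rightarrow> real ^ 'n" where
    "y = (\<lambda>F. \<chi> i. if i \<in> maximizers c F then 1 / card (maximizers c F) else 0)"
  have y: "y F \<in> coord_simplex (maximizers c F)" if "card F = k" for F
  proof -
    have "F \<noteq> {}"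
      using that assms(1) by auto
    then have "maximizers c F \<noteq> {}"
      using maximizers_nonempty[of F c] by simp
    then show ?thesis
      by (simp add: coord_simplex_def y_def flip: sum.inter_filter)
  qed
  have y': "y F \<in> coord_simplex F" if "card F = k" for F
  proof -
    have "maximizers c F \<subseteq> F"
      by (auto simp: maximizers_def)
    with y[OF that] coord_simplex_mono show ?thesis
      by blast
  qed
  have "(\<Sum>F | card F = k. y F) \<in> max_face k (($) a)"
    using y by (intro subsetD[OF sub] iffD2[OF mem_max_face_iff]) blast
  then have "a \<bullet> (\<Sum>F | card F = k. y F) = support_value k a"
    by (simp add: max_face_eq_supporting[OF assms(1)])
  then have "y F \<in> coord_simplex (maximizers (($) a) F)"
    using sum_coord_simplex_eq_iff[OF assms(1) y'] F by blast
  then have "i \<in> maximizers (($) a) F" if "i \<in> maximizers c F" for i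
    using that by (auto simp: coord_simplex_def y_def split: if_splits)
  then show ?thesis
    by blast
qed

section \<open>Level functions\<close>

text \<open>
  The function with value \<open>0\<close> on \<open>Z\<close> and \<open>m + 1\<close> on \<open>X\<^sub>m\<close>. The value \<open>0\<close> need not be attained, as
  \<open>Z\<close> may be empty.
\<close>

definition level_function :: "nat \<Rightarrow> ('n::finite \<Rightarrow> nat) \<Rightarrow> bool" where
  "level_function k f \<longleftrightarrow>
     insert 0 (range f) = {..Max (range f)} \<and> 0 < Max (range f) \<and>
     card (f -` {0}) < k \<and> k \<le> card {i. f i \<le> 1}"

text \<open>Reading levels as real coordinates turns a level function into a functional, so the
  results on supported faces apply to it.\<close>

lemma maximizers_real: "maximizers (($) (\<chi> i. real (f i))) = maximizers f"
  by (auto simp: maximizers_def fun_eq_iff)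

lemma max_face_real: "max_face k (($) (\<chi> i. real (f i))) = max_face k f"
  by (simp add: max_face_def maximizers_real)

section \<open>Recovering a level function from its face\<close>

lemma max_face_eq_imp_maximizers_eq:
  fixes f g :: "'n::finite \<Rightarrow> nat"
  assumes "1 \<le> k" "max_face k f = max_face k g" "card F = k"
  shows "maximizers f F = maximizers g F"
  using max_face_subset_imp_maximizers_subset[OF assms(1), of f "\<chi> i. real (g i)" F]
    max_face_subset_imp_maximizers_subset[OF assms(1), of g "\<chi> i. real (f i)" F] assms
  by (simp add: max_face_real maximizers_real)

text \<open>If a maximizer had level \<open>0\<close>, the whole \<open>k\<close>-set would lie in
  level \<open>0\<close>, which has fewer than \<open>k\<close> elements.\<close>

lemma maximizers_positive:
  fixes f :: "'n::finite \<Rightarrow> nat"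
  assumes "level_function k f" "card F = k" "i \<in> maximizers f F"
  shows "0 < f i"
proof (rule ccontr)
  assume "\<not> 0 < f i"
  then have "F \<subseteq> f -` {0}"
    using assms(3) by (auto simp: maximizers_def)
  then have "k \<le> card (f -` {0})"
    using assms(2) card_mono[of "f -` {0}" F] by simp
  with assms(1) show False
    by (simp add: level_function_def)
qed

text \<open>The elements of level at most \<open>f j\<close> include levels \<open>0\<close> and
  \<open>1\<close>, hence number at least \<open>k\<close>, so \<open>{i, j}\<close> extends to a
  \<open>k\<close>-set among them. Room for both \<open>i\<close> and \<open>j\<close> is where
  \<open>2 \<le> k\<close> enters.\<close>

lemma level_function_exists_set:
  fixes f :: "'n::finite \<Rightarrow> nat"
  assumes f: "level_function k f" and "2 \<le> k" and ij: "0 < f i" "f i \<le> f j"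
  obtains F where "card F = k" "i \<in> F" "j \<in> maximizers f F"
proof -
  have "card {i. f i \<le> 1} \<le> card {z. f z \<le> f j}"
    using ij by (intro card_mono) auto
  then have "k \<le> card {z. f z \<le> f j}"
    using f by (simp add: level_function_def)
  moreover have "card {i, j} \<le> k"
    using assms(2) by (simp add: card_insert_if)
  ultimately obtain F where "{i, j} \<subseteq> F" "F \<subseteq> {z. f z \<le> f j}" "card F = k"
    using exists_subset_between[of "{i, j}" k "{z. f z \<le> f j}"] ij by auto
  then show ?thesis
    by (intro that[of F]) (auto simp: maximizers_def)
qed

text \<open>Here and in \<open>level_function_less_iff\<close> the right-hand side depends on
  \<open>f\<close> only through its maximizers on \<open>k\<close>-sets, which the face determines.
  This yields injectivity.\<close>

lemma level_function_positive_iff: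
  fixes f :: "'n::finite \<Rightarrow> nat"
  assumes "level_function k f" "2 \<le> k"
  shows "0 < f i \<longleftrightarrow> (\<exists>F. card F = k \<and> i \<in> maximizers f F)"
  using assms maximizers_positive level_function_exists_set[of k f i i] by blast

lemma level_function_less_iff:
  fixes f :: "'n::finite \<Rightarrow> nat"
  assumes "level_function k f" "2 \<le> k" "0 < f i" "0 < f j"
  shows "f i < f j \<longleftrightarrow>
    (\<exists>F. card F = k \<and> i \<in> F \<and> i \<notin> maximizers f F \<and> j \<in> maximizers f F)"
proof
  assume "f i < f j"
  then obtain F where "card F = k" "i \<in> F" "j \<in> maximizers f F"
    using level_function_exists_set[of k f i j] assms by auto
  moreover have "i \<notin> maximizers f F"
    using \<open>f i < f j\<close> \<open>j \<in> maximizers f F\<close> by (force simp: maximizers_def)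
  ultimately show "\<exists>F. card F = k \<and> i \<in> F \<and> i \<notin> maximizers f F \<and> j \<in> maximizers f F"
    by blast
qed (fastforce simp: maximizers_def)

lemma level_le_Max: "f i \<le> Max (range f)" for f :: "'n::finite \<Rightarrow> nat"
  by (rule Max_ge) auto

text \<open>A level function is determined by the order it induces, as it skips no positive value.\<close>

lemma level_function_le:
  fixes f g :: "'n::finite \<Rightarrow> nat"
  assumes f: "level_function k f" and zero: "\<And>i. f i = 0 \<longleftrightarrow> g i = 0"
    and less: "\<And>i j. 0 < f i \<Longrightarrow> 0 < f j \<Longrightarrow> f i < f j \<Longrightarrow> g i < g j"
  shows "f i \<le> g i"
proof (induction "f i" arbitrary: i rule: less_induct)
  case (less i)
  show ?case
  proof (rule ccontr)
    assume "\<not> f i \<le> g i"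
    then have lt: "g i < f i"
      by simp
    then have "0 < g i"
      using zero[of i] by (cases "g i") auto
    \<comment> \<open>As \<open>f\<close> skips no positive value, the smaller value
      \<open>g i\<close> is some \<open>f j\<close>. Monotonicity then pushes \<open>g j\<close>
      below \<open>f j\<close>, against the induction hypothesis.\<close>
    have "g i \<in> {..Max (range f)}"
      unfolding atMost_iff using lt level_le_Max[of f i] by linarith
    also have "\<dots> = insert 0 (range f)"
      using f by (simp add: level_function_def)
    finally obtain j where j: "f j = g i"
      using \<open>0 < g i\<close> by auto
    then have "g j < g i"
      using assms(3)[of j i] lt \<open>0 < g i\<close> by simp
    moreover have "f j \<le> g j"
      using less[of j] j lt by simp
    ultimately show False
      using j by simp
  qed
qed

lemma inj_on_max_face:
  assumes "2 \<le> k"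
  shows "inj_on (max_face k) {f :: 'n::finite \<Rightarrow> nat. level_function k f}"
proof (rule inj_onI)
  fix f g :: "'n \<Rightarrow> nat"
  assume "f \<in> {f. level_function k f}" "g \<in> {f. level_function k f}"
  then have f: "level_function k f" and g: "level_function k g"
    by auto
  assume eq: "max_face k f = max_face k g"
  have mx: "maximizers f F = maximizers g F" if "card F = k" for F
    using max_face_eq_imp_maximizers_eq[OF _ eq that] assms by simp
  have pos: "0 < f i \<longleftrightarrow> 0 < g i" for i
    using level_function_positive_iff[OF f assms] level_function_positive_iff[OF g assms] mx by auto
  then have zero: "f i = 0 \<longleftrightarrow> g i = 0" for i
    by (metis gr_zeroI less_irrefl)
  have less: "f i < f j \<longleftrightarrow> g i < g j" if "0 < f i" "0 < f j" for i j
  proof -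
    have "0 < g i" "0 < g j"
      using that pos by auto
    then show ?thesis
      using level_function_less_iff[OF f assms that] level_function_less_iff[OF g assms] mx by auto
  qed
  have "f i \<le> g i" for i
    using zero less pos by (intro level_function_le[OF f]) auto
  moreover have "g i \<le> f i" for i
    using zero less pos by (intro level_function_le[OF g]) auto
  ultimately show "f = g"
    by (auto intro: antisym)
qed

section \<open>From real functionals to level functions\<close>

definition low_set :: "nat \<Rightarrow> ('n::finite \<Rightarrow> real) \<Rightarrow> 'n set" where
  "low_set k c = {i. card {j. c j \<le> c i} < k}"

text \<open>Outside the low set this is the rank of \<open>c i\<close> among the distinct values,
  counted from \<open>1\<close>. Ranking values instead of elements gives ties one level and leaves
  no gaps.\<close>

definition level_of :: "nat \<Rightarrow> ('n::finite \<Rightarrow> real) \<Rightarrow> 'n \<Rightarrow> nat" where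
  "level_of k c i =
     (if i \<in> low_set k c then 0 else card {v \<in> c ` (- low_set k c). v \<le> c i})"

text \<open>The rank is strictly increasing, hence injective, and counting makes it surjective onto
  \<open>{1..card V}\<close>.\<close>

lemma bij_betw_rank:
  fixes V :: "'a::linorder set"
  assumes "finite V"
  shows "bij_betw (\<lambda>v. card {w \<in> V. w \<le> v}) V {1..card V}"
proof -
  have less: "card {w \<in> V. w \<le> u} < card {w \<in> V. w \<le> v}" if "v \<in> V" "u < v" for u v
  proof (rule psubset_card_mono)
    have "v \<in> {w \<in> V. w \<le> v} - {w \<in> V. w \<le> u}"
      using that by auto
    moreover have "{w \<in> V. w \<le> u} \<subseteq> {w \<in> V. w \<le> v}"
      using that by auto
    ultimately show "{w \<in> V. w \<le> u} \<subset> {w \<in> V. w \<le> v}"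
      by blast
  qed (use assms in simp)
  have "inj_on (\<lambda>v. card {w \<in> V. w \<le> v}) V"
  proof (rule inj_onI)
    fix u v assume "u \<in> V" "v \<in> V" "card {w \<in> V. w \<le> u} = card {w \<in> V. w \<le> v}"
    then show "u = v"
      using less[of u v] less[of v u] by (metis less_irrefl linorder_less_linear)
  qed
  moreover have "(\<lambda>v. card {w \<in> V. w \<le> v}) ` V \<subseteq> {1..card V}"
    using assms by (auto simp: Suc_le_eq card_gt_0_iff intro!: card_mono)
  ultimately show ?thesis
    using assms by (simp add: bij_betw_def card_image card_subset_eq)
qed

lemma low_set_downward:
  assumes "i \<in> low_set k c" "c j \<le> c i"
  shows "j \<in> low_set k c"
proof -
  have "card {l. c l \<le> c j} \<le> card {l. c l \<le> c i}"
    using assms(2) by (intro card_mono) auto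
  with assms(1) show ?thesis
    by (simp add: low_set_def)
qed

lemma level_of_pos_iff: "0 < level_of k c i \<longleftrightarrow> i \<notin> low_set k c"
  by (auto simp: level_of_def card_gt_0_iff)

lemma level_of_le_iff:
  assumes "j \<notin> low_set k c"
  shows "level_of k c i \<le> level_of k c j \<longleftrightarrow> i \<in> low_set k c \<or> c i \<le> c j"
proof (cases "i \<in> low_set k c")
  case False
  let ?V = "c ` (- low_set k c)"
  have "card {v \<in> ?V. v \<le> c i} \<le> card {v \<in> ?V. v \<le> c j} \<longleftrightarrow> c i \<le> c j"
  proof
    assume le: "card {v \<in> ?V. v \<le> c i} \<le> card {v \<in> ?V. v \<le> c j}"
    show "c i \<le> c j"
    proof (rule ccontr)
      assume "\<not> c i \<le> c j"
      then have "card {v \<in> ?V. v \<le> c j} < card {v \<in> ?V. v \<le> c i}"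
        using False by (intro psubset_card_mono) auto
      with le show False
        by simp
    qed
  next
    assume "c i \<le> c j"
    then show "card {v \<in> ?V. v \<le> c i} \<le> card {v \<in> ?V. v \<le> c j}"
      by (intro card_mono) auto
  qed
  with False assms show ?thesis
    by (simp add: level_of_def)
qed (simp add: level_of_def)

lemma maximizers_not_low:
  assumes "card F = k" "i \<in> maximizers c F"
  shows "i \<notin> low_set k c"
proof -
  have "card F \<le> card {j. c j \<le> c i}"
    using assms(2) by (intro card_mono) (auto simp: maximizers_def)
  with assms(1) show ?thesis
    by (simp add: low_set_def)
qed

text \<open>Passing to levels keeps the order outside the low set and merges the low elements at the
  bottom; no maximizer of a \<open>k\<close>-set is low.\<close>

lemma maximizers_level_of:
  fixes c :: "'n::finite \<Rightarrow> real"
  assumes "1 \<le> k" "card F = k"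
  shows "maximizers (level_of k c) F = maximizers c F"
proof -
  have "F \<noteq> {}"
    using assms by auto
  then obtain m where m: "m \<in> maximizers c F"
    using maximizers_nonempty[of F c] by auto
  then have "m \<in> F" and m_high: "m \<notin> low_set k c"
    using maximizers_not_low[OF assms(2)] by (auto simp: maximizers_def)
  show ?thesis
  proof (intro equalityI subsetI)
    fix i assume i: "i \<in> maximizers (level_of k c) F"
    then have "level_of k c m \<le> level_of k c i"
      using \<open>m \<in> F\<close> by (auto simp: maximizers_def)
    then have high: "i \<notin> low_set k c"
      using m_high level_of_pos_iff[of k c] by (metis less_le_trans)
    have "c j \<le> c i" if "j \<in> F" for j
    proof (cases "j \<in> low_set k c")
      case True
      then show ?thesis
        using low_set_downward[of j k c i] high by linarith
    next
      case False
      then show ?thesis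
        using level_of_le_iff[OF high] i that by (auto simp: maximizers_def)
    qed
    with i show "i \<in> maximizers c F"
      by (auto simp: maximizers_def)
  next
    fix i assume i: "i \<in> maximizers c F"
    with maximizers_not_low[OF assms(2)] have "i \<notin> low_set k c"
      by blast
    with i show "i \<in> maximizers (level_of k c) F"
      by (auto simp: maximizers_def level_of_le_iff)
  qed
qed

lemma level_function_level_of:
  fixes c :: "'n::finite \<Rightarrow> real"
  assumes k: "1 \<le> k" "k \<le> CARD('n)"
  shows "level_function k (level_of k c)"
proof -
  let ?Z = "low_set k c" and ?f = "level_of k c"
  let ?V = "c ` (- ?Z)"
  obtain F :: "'n set" where F: "card F = k"
    using obtain_subset_with_card_n[OF k(2)] by blast
  with k have "F \<noteq> {}"
    by auto
  with maximizers_nonempty[of F c] maximizers_not_low[OF F, of _ c] have high: "- ?Z \<noteq> {}"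
    by fastforce
  have "(\<lambda>v. card {w \<in> ?V. w \<le> v}) ` ?V = {1..card ?V}"
    using bij_betw_rank[of ?V] by (simp add: bij_betw_def)
  then have "?f ` (- ?Z) = {1..card ?V}"
    unfolding image_image by (auto simp: level_of_def cong: image_cong)
  moreover have "?f ` ?Z \<subseteq> {0}"
    by (auto simp: level_of_def)
  moreover have "range ?f = ?f ` (- ?Z) \<union> ?f ` ?Z"
    by auto
  ultimately have range: "insert 0 (range ?f) = {..card ?V}" and sub: "{1..card ?V} \<subseteq> range ?f"
    by auto
  have pos: "0 < card ?V"
    using high by (simp add: card_gt_0_iff)
  have "Max (range ?f) = card ?V"
    using range sub pos by (intro Max_eqI) auto
  moreover have "card (?f -` {0}) < k"
  proof -
    have "?f i = 0 \<longleftrightarrow> i \<in> ?Z" for i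
      using level_of_pos_iff[of k c i] by (cases "?f i") auto
    then have eq: "?f -` {0} = ?Z"
      by auto
    show ?thesis
    proof (cases "?Z = {}")
      case False
      \<comment> \<open>The largest low element has the entire low set at or below it and, being
        low, has fewer than \<open>k\<close> elements there.\<close>
      then obtain i where i: "i \<in> maximizers c ?Z"
        using maximizers_nonempty[of ?Z c] by auto
      then have "card ?Z \<le> card {j. c j \<le> c i}"
        by (intro card_mono) (auto simp: maximizers_def)
      also have "\<dots> < k"
        using i by (auto simp: maximizers_def low_set_def)
      finally show ?thesis
        by (simp add: eq)
    qed (use k eq in simp)
  qed
  moreover have "k \<le> card {i. ?f i \<le> 1}"
  proof -
    \<comment> \<open>An element of level \<open>1\<close> is not low, so at least \<open>k\<close>
      elements lie at or below it, and these all have level at most \<open>1\<close>.\<close>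
    obtain m where m: "?f m = 1"
      using subsetD[OF sub, of 1] pos by (auto simp: Suc_le_eq)
    then have "m \<notin> ?Z"
      using level_of_pos_iff[of k c m] by simp
    then have "k \<le> card {j. c j \<le> c m}"
      by (simp add: low_set_def)
    also have "\<dots> \<le> card {i. ?f i \<le> 1}"
      using level_of_le_iff[OF \<open>m \<notin> ?Z\<close>] m by (intro card_mono) auto
    finally show ?thesis .
  qed
  ultimately show ?thesis
    using range pos by (simp add: level_function_def)
qed

lemma bij_betw_max_face:
  assumes "2 \<le> k" "k \<le> CARD('n::finite)"
  shows "bij_betw (max_face k) {f :: 'n \<Rightarrow> nat. level_function k f}
    {T. T face_of simplex_sum k \<and> T \<noteq> {}}"
proof -
  have k: "1 \<le> k"
    using assms by simp
  have "max_face k ` {f :: 'n \<Rightarrow> nat. level_function k f} =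
      {T. \<exists>a :: real ^ 'n. T = max_face k (($) a)}"
  proof (intro equalityI subsetI)
    fix T :: "(real ^ 'n) set"
    assume "T \<in> max_face k ` {f :: 'n \<Rightarrow> nat. level_function k f}"
    then obtain f :: "'n \<Rightarrow> nat" where "T = max_face k f"
      by blast
    then have "T = max_face k (($) (\<chi> i. real (f i)))"
      by (simp only: max_face_real)
    then show "T \<in> {T. \<exists>a :: real ^ 'n. T = max_face k (($) a)}"
      by (intro CollectI exI)
  next
    fix T assume "T \<in> {T. \<exists>a :: real ^ 'n. T = max_face k (($) a)}"
    then obtain a :: "real ^ 'n" where "T = max_face k (($) a)"
      by blast
    also have "\<dots> = max_face k (level_of k (($) a))"
      using k by (intro max_face_cong) (simp add: maximizers_level_of)
    finally show "T \<in> max_face k ` {f :: 'n \<Rightarrow> nat. level_function k f}"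
      using level_function_level_of[OF k assms(2)] by (intro image_eqI) auto
  qed
  then show ?thesis
    using inj_on_max_face[OF assms(1)] by (simp add: bij_betw_def face_of_simplex_sum_iff[OF k])
qed

section \<open>Ordered pseudo-partitions\<close>

definition level_partition :: "('n::finite \<Rightarrow> nat) \<Rightarrow> 'n set \<times> 'n set list" where
  "level_partition f = (f -` {0}, map (\<lambda>m. f -` {Suc m}) [0..<Max (range f)])"

text \<open>Whether \<open>Z\<close> is empty decides which alternative of the definition applies;
  disjointness of the longer family passes to its tail.\<close>

lemma ordered_pseudo_partition_iff:
  "ordered_pseudo_partition A Z Xs \<longleftrightarrow>
     Xs \<noteq> [] \<and> {} \<notin> set Xs \<and> \<Union>(set (Z # Xs)) = A \<and>
     disjoint_family_on (\<lambda>i. (Z # Xs) ! i) {..<length (Z # Xs)}"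
proof -
  have tail: "disjoint_family_on (\<lambda>i. Xs ! i) {..<length Xs}"
    if "disjoint_family_on (\<lambda>i. (Z # Xs) ! i) {..<length (Z # Xs)}"
    using that unfolding disjoint_family_on_def
    by (metis Suc_less_eq length_Cons lessThan_iff nat.inject nth_Cons_Suc)
  show ?thesis
    unfolding ordered_pseudo_partition_def ordered_partition_def
    using tail by (cases "Z = {}") auto
qed

text \<open>Listing \<open>Z\<close> in front makes position equal to level, which absorbs the index
  shift in \<open>Xs\<close>.\<close>

lemma nth_level_partition:
  assumes "m \<le> Max (range f)"
  shows "(fst (level_partition f) # snd (level_partition f)) ! m = f -` {m}"
  using assms by (cases m) (auto simp: level_partition_def)

lemma length_level_partition: "length (snd (level_partition f)) = Max (range f)"
  by (simp add: level_partition_def)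

lemma card_level_le_one:
  fixes f :: "'n::finite \<Rightarrow> nat"
  shows "card {i. f i \<le> 1} = card (f -` {0}) + card (f -` {1})"
proof -
  have "{i. f i \<le> 1} = f -` {0} \<union> f -` {1}"
    by (auto simp: le_Suc_eq)
  then show ?thesis
    by (simp add: card_Un_disjoint disjoint_iff)
qed

definition admissible_partitions :: "nat \<Rightarrow> ('n::finite set \<times> 'n set list) set" where
  "admissible_partitions k = {(Z, Xs). ordered_pseudo_partition UNIV Z Xs \<and>
     card Z \<in> {0..k - 1} \<and> card Z + card (hd Xs) \<in> {k..CARD('n)}}"

lemma inj_level_partition: "inj level_partition"
proof (rule injI)
  fix f g :: "'n::finite \<Rightarrow> nat"
  assume eq: "level_partition f = level_partition g"
  then have "Max (range f) = Max (range g)"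
    by (metis length_level_partition)
  then have "f -` {f i} = g -` {f i}" for i
    using eq nth_level_partition level_le_Max by metis
  then have "i \<in> g -` {f i}" for i
    by blast
  then show "f = g"
    by (intro ext) simp
qed

lemma level_partition_admissible:
  fixes f :: "'n::finite \<Rightarrow> nat"
  assumes f: "level_function k f"
  shows "level_partition f \<in> admissible_partitions k"
proof -
  obtain Z Xs where ZXs: "level_partition f = (Z, Xs)"
    by (cases "level_partition f")
  have len: "length Xs = Max (range f)"
    using length_level_partition[of f] ZXs by simp
  have nth: "(Z # Xs) ! m = f -` {m}" if "m \<le> length Xs" for m
    using nth_level_partition[of m f] ZXs that len by simp
  have pos: "0 < length Xs"
    using f len by (simp add: level_function_def)
  have Z: "Z = f -` {0}"
    using nth[of 0] by simp
  have hd: "hd Xs = f -` {1}"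
    using nth[of 1] pos by (simp add: hd_conv_nth Suc_le_eq)
  have "f -` {Suc m} \<noteq> {}" if "m < length Xs" for m
  proof -
    have "Suc m \<in> insert 0 (range f)"
      using f that len by (auto simp: level_function_def)
    then show ?thesis
      by auto
  qed
  then have "{} \<notin> set Xs"
    using nth by (auto simp: in_set_conv_nth) (metis Suc_leI nth_Cons_Suc)
  moreover have "\<Union>(set (Z # Xs)) = UNIV"
  proof -
    have "i \<in> (Z # Xs) ! f i" "f i < length (Z # Xs)" for i
      using nth[of "f i"] level_le_Max[of f i] len by (auto simp: less_Suc_eq_le)
    then show ?thesis
      using nth_mem by blast
  qed
  moreover have "disjoint_family_on (\<lambda>i. (Z # Xs) ! i) {..<length (Z # Xs)}"
    using nth by (auto simp: disjoint_family_on_def less_Suc_eq_le)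
  ultimately have "ordered_pseudo_partition UNIV Z Xs"
    using pos by (simp add: ordered_pseudo_partition_iff del: set_simps)
  moreover have "card Z + card (hd Xs) = card {i. f i \<le> 1}"
    by (simp only: Z hd card_level_le_one)
  moreover have "card {i. f i \<le> 1} \<le> CARD('n)"
    by (intro card_mono) auto
  ultimately show ?thesis
    using f Z by (auto simp: admissible_partitions_def ZXs level_function_def)
qed

lemma admissible_partition_is_level_partition:
  fixes Z :: "'n::finite set"
  assumes adm: "(Z, Xs) \<in> admissible_partitions k" and "1 \<le> k"
  shows "\<exists>f. level_function k f \<and> level_partition f = (Z, Xs)"
proof -
  have opp: "ordered_pseudo_partition UNIV Z Xs"
    using adm by (simp add: admissible_partitions_def)
  then have "Xs \<noteq> []" and ne: "{} \<notin> set Xs" and un: "\<Union>(set (Z # Xs)) = UNIV"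
    and disj: "disjoint_family_on (\<lambda>i. (Z # Xs) ! i) {..<length (Z # Xs)}"
    unfolding ordered_pseudo_partition_iff by blast+
  have "\<exists>m < length (Z # Xs). i \<in> (Z # Xs) ! m" for i
  proof -
    have "i \<in> \<Union>(set (Z # Xs))"
      using un by simp
    then show ?thesis
      by (metis Union_iff in_set_conv_nth)
  qed
  \<comment> \<open>\<open>f i\<close> is the position of a block containing \<open>i\<close>;
    disjointness makes the blocks exactly the fibres of \<open>f\<close>.\<close>
  then obtain f where f: "\<And>i. f i < length (Z # Xs)" "\<And>i. i \<in> (Z # Xs) ! f i"
    by metis
  have nth: "(Z # Xs) ! m = f -` {m}" if "m \<le> length Xs" for m
  proof -
    have "f i = m" if "i \<in> (Z # Xs) ! m" for i
      using disjoint_family_onD[OF disj, of "f i" m] f[of i] that \<open>m \<le> length Xs\<close> by auto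
    with f(2) show ?thesis
      by auto
  qed
  have Z: "Z = f -` {0}"
    using nth[of 0] by simp
  have X: "Xs ! m = f -` {Suc m}" if "m < length Xs" for m
    using nth[of "Suc m"] that by simp
  have sub: "Suc m \<in> range f" if "m < length Xs" for m
  proof -
    have "f -` {Suc m} \<noteq> {}"
      using ne nth_mem[OF that] X[OF that] by auto
    then obtain i where "f i = Suc m"
      by auto
    then show ?thesis
      by (metis rangeI)
  qed
  have Max: "Max (range f) = length Xs"
  proof (rule Max_eqI)
    show "length Xs \<in> range f"
      using sub[of "length Xs - 1"] \<open>Xs \<noteq> []\<close> by simp
  qed (use f in \<open>auto simp: less_Suc_eq_le\<close>)
  have "insert 0 (range f) = {..length Xs}"
  proof (intro equalityI subsetI)
    fix m assume "m \<in> {..length Xs}"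
    then show "m \<in> insert 0 (range f)"
      using sub[of "m - 1"] by (cases m) auto
  qed (use f in \<open>auto simp: less_Suc_eq_le\<close>)
  moreover have "hd Xs = f -` {1}"
    using X[of 0] \<open>Xs \<noteq> []\<close> by (simp add: hd_conv_nth)
  ultimately have "level_function k f"
    using adm assms(2) Max \<open>Xs \<noteq> []\<close> Z card_level_le_one[of f]
    by (auto simp: level_function_def admissible_partitions_def)
  moreover have "level_partition f = (Z, Xs)"
    using Z X Max by (auto simp: level_partition_def intro!: nth_equalityI)
  ultimately show ?thesis
    by blast
qed

lemma bij_betw_level_partition:
  assumes "1 \<le> k"
  shows "bij_betw level_partition {f :: 'n::finite \<Rightarrow> nat. level_function k f}
    (admissible_partitions k)"
  unfolding bij_betw_def
proof
  show "inj_on level_partition {f :: 'n \<Rightarrow> nat. level_function k f}"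
    using inj_level_partition by (rule inj_on_subset) simp
  show "level_partition ` {f :: 'n \<Rightarrow> nat. level_function k f} = admissible_partitions k"
    using level_partition_admissible admissible_partition_is_level_partition[OF _ assms]
    by (fastforce simp: image_iff)
qed

section \<open>Dimension\<close>

text \<open>\<open>inv f\<close> selects one representative of each level from \<open>1\<close> to
  \<open>Max (range f)\<close>, all of which are attained. The non-representatives in the first term
  will index a basis of the direction space.\<close>

lemma card_non_representatives:
  fixes f :: "'n::finite \<Rightarrow> nat"
  assumes f: "level_function k f"
  shows "card {i. 0 < f i \<and> inv f (f i) \<noteq> i} + card (f -` {0}) + Max (range f) = CARD('n)"
proof -
  let ?I = "{i. 0 < f i \<and> inv f (f i) \<noteq> i}" and ?R = "{i. 0 < f i \<and> inv f (f i) = i}"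
  have range: "{1..Max (range f)} \<subseteq> range f"
  proof
    fix m assume "m \<in> {1..Max (range f)}"
    then have "m \<in> insert 0 (range f)" "m \<noteq> 0"
      using f by (auto simp: level_function_def)
    then show "m \<in> range f"
      by blast
  qed
  have "?R = inv f ` {1..Max (range f)}"
  proof (intro equalityI subsetI)
    fix i assume "i \<in> ?R"
    then show "i \<in> inv f ` {1..Max (range f)}"
      using level_le_Max[of f i] by (intro image_eqI[of _ _ "f i"]) auto
  next
    fix i assume "i \<in> inv f ` {1..Max (range f)}"
    then obtain m where "m \<in> {1..Max (range f)}" "i = inv f m"
      by blast
    moreover from this range have "f (inv f m) = m"
      by (intro f_inv_into_f) blast
    ultimately show "i \<in> ?R"
      by simp
  qed
  moreover have "inj_on (inv f) {1..Max (range f)}"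
    using inj_on_inv_into[OF range] .
  ultimately have R: "card ?R = Max (range f)"
    by (simp add: card_image)
  have "UNIV = (?I \<union> f -` {0}) \<union> ?R"
    by auto
  then have "CARD('n) = card ((?I \<union> f -` {0}) \<union> ?R)"
    by (rule arg_cong)
  also have "\<dots> = card (?I \<union> f -` {0}) + card ?R"
    by (intro card_Un_disjoint) auto
  also have "card (?I \<union> f -` {0}) = card ?I + card (f -` {0})"
    by (intro card_Un_disjoint) auto
  finally show ?thesis
    using R by simp
qed

text \<open>
  The vectors \<open>e\<^sub>i - e\<^bsub>s i\<^esub>\<close>, where \<open>s i\<close> is a fixed representative of the level of \<open>i\<close>, form a
  basis of the direction space of the face when \<open>i\<close> ranges over the non-representatives of
  positive level.
\<close>

lemma independent_axis_differences:
  fixes s :: "'n::finite \<Rightarrow> 'n"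
  assumes s: "\<And>i j. i \<in> I \<Longrightarrow> j \<in> I \<Longrightarrow> s i \<noteq> j"
  shows "independent ((\<lambda>i. axis i 1 - axis (s i) 1 :: real ^ 'n) ` I)"
    and "inj_on (\<lambda>i. axis i 1 - axis (s i) 1 :: real ^ 'n) I"
proof -
  let ?b = "\<lambda>i. axis i 1 - axis (s i) 1 :: real ^ 'n"
  have coord: "?b i $ j = (if i = j then 1 else 0)" if "i \<in> I" "j \<in> I" for i j
    using s[OF that] by (auto simp: axis_def)
  show inj: "inj_on ?b I"
  proof (rule inj_onI)
    fix i j assume ij: "i \<in> I" "j \<in> I" "?b i = ?b j"
    then have "?b j $ i = 1"
      using coord[of i i] by simp
    with coord[of j i] ij show "i = j"
      by (auto split: if_splits)
  qed
  show "independent (?b ` I)"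
  proof
    assume "dependent (?b ` I)"
    then obtain u j where j: "j \<in> I" "u (?b j) \<noteq> 0" and "(\<Sum>v\<in>?b ` I. u v *\<^sub>R v) = 0"
      by (auto simp: dependent_finite)
    then have "(\<Sum>i\<in>I. u (?b i) *\<^sub>R ?b i) $ j = 0"
      by (simp add: sum.reindex[OF inj])
    then have "(\<Sum>i\<in>I. u (?b i) * (?b i $ j)) = 0"
      by simp
    also have "(\<Sum>i\<in>I. u (?b i) * (?b i $ j)) = (\<Sum>i\<in>I. if i = j then u (?b i) else 0)"
      using j coord by (intro sum.cong) auto
    also have "\<dots> = u (?b j)"
      using j by simp
    finally show False
      using j by simp
  qed
qed

text \<open>The face translated by one of its points and the differences \<open>b i\<close> span the
  same space. In the notation of the pseudo-partition, \<open>Max (range f)\<close> is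
  \<open>p + 1\<close>.\<close>

lemma aff_dim_max_face:
  fixes f :: "'n::finite \<Rightarrow> nat"
  assumes f: "level_function k f" and "2 \<le> k"
  shows "aff_dim (max_face k f) = int CARD('n) - int (card (f -` {0})) - int (Max (range f))"
proof -
  define s where "s i = inv f (f i)" for i
  define I where "I = {i. 0 < f i \<and> s i \<noteq> i}"
  define b where "b i = (axis i 1 - axis (s i) 1 :: real ^ 'n)" for i
  have fs: "f (s i) = f i" for i
    unfolding s_def by (rule f_inv_into_f) simp
  then have "s (s i) = s i" for i
    by (simp add: s_def)
  then have "s i \<noteq> j" if "j \<in> I" for i j
    using that by (auto simp: I_def)
  then have indep: "independent (b ` I)" and inj: "inj_on b I"
    using independent_axis_differences[of I s] unfolding b_def by blast+
  have b_span: "b i \<in> span (b ` I)" if "0 < f i" for i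
  proof (cases "s i = i")
    case True
    then show ?thesis
      by (simp add: b_def span_zero)
  next
    case False
    with that show ?thesis
      by (intro span_base imageI) (simp add: I_def)
  qed
  obtain x0 where x0: "x0 \<in> max_face k f"
    using max_face_nonempty[of k f] assms(2) by auto
  let ?D = "(+) (- x0) ` max_face k f"
  have "?D \<subseteq> span (b ` I)"
  proof
    fix v assume "v \<in> ?D"
    then obtain x where x: "x \<in> max_face k f" and v: "v = x - x0"
      by auto
    from x x0 obtain y y0 where y: "\<And>F. card F = k \<Longrightarrow> y F \<in> coord_simplex (maximizers f F)"
      and y0: "\<And>F. card F = k \<Longrightarrow> y0 F \<in> coord_simplex (maximizers f F)"
      and xs: "x = (\<Sum>F | card F = k. y F)" "x0 = (\<Sum>F | card F = k. y0 F)"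
      unfolding mem_max_face_iff by blast
    have "y F - y0 F \<in> span (b ` I)" if F: "card F = k" for F
    proof -
      let ?G = "maximizers f F" and ?w = "y F - y0 F"
      have "F \<noteq> {}"
        using F assms(2) by auto
      then obtain m where m: "m \<in> ?G"
        using maximizers_nonempty[of F f] by auto
      have same: "s i = s m" if "i \<in> ?G" for i
      proof -
        have "f i = f m"
          using that m by (auto simp: maximizers_def intro: antisym)
        then show ?thesis
          by (simp add: s_def)
      qed
      have out: "?w $ i = 0" if "i \<notin> ?G" for i
        using that y[OF F] y0[OF F] by (simp add: coord_simplex_def)
      have "(\<Sum>i\<in>?G. ?w $ i) = (\<Sum>i\<in>UNIV. ?w $ i)"
        using out by (intro sum.mono_neutral_left) auto
      also have "\<dots> = 0"
        using y[OF F] y0[OF F] by (simp add: coord_simplex_def sum_subtractf)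
      finally have zero: "(\<Sum>i\<in>?G. ?w $ i) = 0" .
      have "?w = (\<Sum>i\<in>UNIV. ?w $ i *\<^sub>R axis i 1)"
        using basis_expansion[of ?w] by (simp add: scalar_mult_eq_scaleR)
      also have "\<dots> = (\<Sum>i\<in>?G. ?w $ i *\<^sub>R axis i 1)"
        using out by (intro sum.mono_neutral_right) auto
      \<comment> \<open>Replacing each \<open>axis i 1\<close> by \<open>b i\<close> leaves a
        multiple of one axis vector, since all of \<open>?G\<close> has one representative. Its
        coefficient is the coordinate sum of \<open>?w\<close>, which is \<open>0\<close>.\<close>
      also have "\<dots> = (\<Sum>i\<in>?G. ?w $ i *\<^sub>R b i) + (\<Sum>i\<in>?G. ?w $ i *\<^sub>R axis (s i) 1)"
        unfolding b_def by (simp add: scaleR_diff_right sum.distrib[symmetric] del: vector_minus_component)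
      also have "(\<Sum>i\<in>?G. ?w $ i *\<^sub>R axis (s i) 1) = (\<Sum>i\<in>?G. ?w $ i *\<^sub>R axis (s m) (1 :: real))"
        using same by (intro sum.cong) auto
      also have "\<dots> = 0"
        unfolding scaleR_sum_left[symmetric] zero by simp
      finally have "?w = (\<Sum>i\<in>?G. ?w $ i *\<^sub>R b i)"
        by (simp only: add_0_right)
      also have "\<dots> \<in> span (b ` I)"
        using maximizers_positive[OF f F] by (intro span_sum span_scale b_span)
      finally show ?thesis .
    qed
    then have "(\<Sum>F | card F = k. y F - y0 F) \<in> span (b ` I)"
      by (intro span_sum) auto
    then show "v \<in> span (b ` I)"
      by (simp add: v xs sum_subtractf)
  qed
  moreover have "b ` I \<subseteq> span ?D"
  proof
    fix v assume "v \<in> b ` I"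
    then obtain i where i: "0 < f i" and v: "v = b i"
      by (auto simp: I_def)
    \<comment> \<open>Since \<open>i\<close> and \<open>s i\<close> have the same level, both are
      maximizers on this \<open>F\<close>.\<close>
    obtain F where F: "card F = k" "i \<in> F" "s i \<in> maximizers f F"
      using level_function_exists_set[OF f assms(2) i, of "s i"] fs by auto
    have iF: "i \<in> maximizers f F"
      using F fs[of i] by (auto simp: maximizers_def)
    from x0 obtain y where y: "\<And>F. card F = k \<Longrightarrow> y F \<in> coord_simplex (maximizers f F)"
      unfolding mem_max_face_iff by blast
    \<comment> \<open>\<open>p i\<close> and \<open>p (s i)\<close> agree in every summand except
      the one for \<open>F\<close>, where they use the vertices \<open>i\<close> and
      \<open>s i\<close>; so they differ by \<open>b i\<close>.\<close>
    define p where "p j = (\<Sum>G | card G = k. if G = F then axis j 1 else y G)" for j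
    have p: "p j \<in> max_face k f" if "j \<in> maximizers f F" for j
      unfolding mem_max_face_iff p_def
      using y axis_mem_coord_simplex[OF that]
      by (intro exI[of _ "\<lambda>G. if G = F then axis j 1 else y G"]) auto
    have "p i - p (s i) = (\<Sum>G | card G = k. if G = F then b i else 0)"
      unfolding p_def sum_subtractf[symmetric] by (intro sum.cong) (auto simp: b_def)
    also have "\<dots> = b i"
      using F(1) by simp
    finally have "b i = (- x0 + p i) - (- x0 + p (s i))"
      by simp
    then show "v \<in> span ?D"
      unfolding v using p[OF iF] p[OF F(3)] by (metis imageI span_base span_diff)
  qed
  ultimately have "span ?D = span (b ` I)"
    by (metis span_mono span_span subset_antisym)
  then have "dim ?D = card I"
    using indep inj by (metis card_image dim_eq_card_independent dim_span)
  moreover have "aff_dim (max_face k f) = int (dim ?D)"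
    using aff_dim_eq_dim[of x0 "max_face k f"] hull_inc[OF x0] by auto
  ultimately show ?thesis
    using card_non_representatives[OF f] by (simp add: I_def s_def)
qed

section \<open>The bijection with its dimension formula\<close>

theorem theorem4p10:
  fixes k :: nat
  assumes "k \<in> {2..CARD('n::finite)}"
  shows "\<exists>\<Phi> :: (real ^ 'n) set \<Rightarrow> 'n set \<times> 'n set list.
     bij_betw \<Phi>
       {T. T face_of simplex_sum k \<and> T \<noteq> {}}
       {(Z, Xs). ordered_pseudo_partition UNIV Z Xs \<and>
                 card Z \<in> {0..k - 1} \<and>
                 card Z + card (hd Xs) \<in> {k..CARD('n)}} \<and>
     (\<forall>T Z Xs. T face_of simplex_sum k \<and> T \<noteq> {} \<and> \<Phi> T = (Z, Xs) \<longrightarrow>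
        int CARD('n) - int (card Z) - int (length Xs - 1) - 1 = aff_dim T)"
proof -
  let ?L = "{f :: 'n \<Rightarrow> nat. level_function k f}"
  let ?faces = "{T :: (real ^ 'n) set. T face_of simplex_sum k \<and> T \<noteq> {}}"
  have k: "2 \<le> k" "k \<le> CARD('n)" "1 \<le> k"
    using assms by auto
  define g :: "(real ^ 'n) set \<Rightarrow> 'n \<Rightarrow> nat" where "g = inv_into ?L (max_face k)"
  have faces: "bij_betw (max_face k) ?L ?faces"
    using bij_betw_max_face k by blast
  then have g: "bij_betw g ?faces ?L"
    unfolding g_def by (rule bij_betw_inv_into)
  have "bij_betw (level_partition \<circ> g) ?faces (admissible_partitions k)"
    using g bij_betw_level_partition[OF k(3)] by (rule bij_betw_trans)
  moreover have "int CARD('n) - int (card Z) - int (length Xs - 1) - 1 = aff_dim T"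
    if T: "T \<in> ?faces" and ZXs: "(level_partition \<circ> g) T = (Z, Xs)" for T Z Xs
  proof -
    have f: "level_function k (g T)"
      using bij_betwE[OF g] T by blast
    have "max_face k (g T) = T"
      using bij_betw_inv_into_right[OF faces T] by (simp add: g_def)
    moreover have "length Xs = Max (range (g T))" "Z = g T -` {0}"
      using ZXs by (auto simp: level_partition_def)
    \<comment> \<open>Positivity makes the natural-number subtraction in
      \<open>length Xs - 1\<close> exact.\<close>
    moreover have "0 < Max (range (g T))"
      using f by (simp add: level_function_def)
    ultimately show ?thesis
      using aff_dim_max_face[OF f k(1)] by simp
  qed
  ultimately show ?thesis
    unfolding admissible_partitions_def by (intro exI[of _ "level_partition \<circ> g"]) blast
qed

end
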